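(* Let $\zeta_1,\zeta_2\in wAC(P)$ and $\alpha\in\{0,1\}$. Then $\zeta_1\equiv\zeta_2$ if and only if $[\zeta_1]^{\alpha}\cong[\zeta_2]^{\alpha}$.
   Context: $(K,\oplus,\otimes,\hat0,\hat1)$ is a commutative, additively idempotent semiring; $P$ is a finite nonempty set of ports with $0,1\notin P$ and weights $k_p\in K$. $wAI(P)$ is the weighted Algebra of Interactions: terms $z::=0\mid1\mid p\mid z\oplus z\mid z\otimes z\mid(z)$, with semantics $\|z\|(\gamma)\in K$ for $\gamma\in\Gamma(P)=2^{2^P}$: $\|0\|(\gamma)=\hat0$; $\|1\|(\gamma)=\hat1$ iff $\emptyset\in\gamma$ (else $\hat0$); $\|p\|(\gamma)=k_p$ if some $a\in\gamma$ contains $p$ (else $\hat0$); $\|z_1\oplus z_2\|(\gamma)=\bigoplus_{a\in\gamma}(\|z_1\|(\{a\})\oplus\|z_2\|(\{a\}))$; $\|z_1\otimes z_2\|(\gamma)=\bigoplus_{a\in\gamma}\bigoplus_{a_1\cup a_2=a}(\|z_1\|(\{a_1\})\otimes\|z_2\|(\{a_2\}))$ (inner sum over pairs of possibly empty subsets of $P$); $\|(z)\|=\|z\|$. On $wAI(P)$, $z_1\equiv z_2$ iff $\|z_1\|=\|z_2\|$ on all of $\Gamma(P)$; $wAI(P)/\equiv$ is a commutative idempotent semiring under $\oplus,\otimes$ with zero $\overline0$ and one $\overline1$, and computations with $wAI(P)$ terms are done in it. The weighted Algebra of Connectors $wAC(Q)$ over a port set $Q$ has syntax: synchrons $\sigma::=[0]\mid[1]\mid[p]\mid[\zeta]$,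 triggers $\tau::=[0]'\mid[1]'\mid[p]'\mid[\zeta]'$ ($p\in Q$), and $\zeta::=\sigma\mid\tau\mid\zeta\oplus\zeta\mid\zeta\otimes\zeta$, where weighted fusion $\otimes$ is applied to typed connectors; $[\zeta]^{\alpha}$ is $[\zeta]$ if $\alpha=0$ and $[\zeta]'$ if $\alpha=1$. Semantics $|\cdot|$ into $wAI$: $|[p]|=|[p]'|=p$ for $p\in Q\cup\{0,1\}$; $|[\zeta]|=|[\zeta]'|=|\zeta|$; $|\zeta_1\oplus\zeta_2|=|\zeta_1|\oplus|\zeta_2|$; $|[\zeta_1]\otimes\cdots\otimes[\zeta_n]|=|\zeta_1|\otimes\cdots\otimes|\zeta_n|$; and if at least one $\alpha_i=1$, $|[\zeta_1]^{\alpha_1}\otimes\cdots\otimes[\zeta_n]^{\alpha_n}|=\bigoplus_{i:\alpha_i=1}\big(|\zeta_i|\otimes\bigotimes_{k\ne i,\alpha_k=1}(1\oplus|\zeta_k|)\otimes\bigotimes_{j:\alpha_j=0}(1\oplus|\zeta_j|)\big)$. Connectors are equivalent, $\zeta_1\equiv\zeta_2$, iff $|\zeta_1|\equiv|\zeta_2|$. The weighted congruence $\cong$ on $wAC(P)$ is the largest relation contained in $\equiv$ such that, for a fresh port $r\notin P$, $\zeta_1\cong\zeta_2$ implies $E(\zeta_1/r)\equiv E(\zeta_2/r)$ for every $E\in wAC(P\cup\{r\})$, where $E(\zeta/r)$ is obtained from $E$ by replacing every occurrence of the connector $r$ by $\zeta$. *)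

theory Defs
  imports Main
begin

section \<open>The weighted Algebra of Interactions\<close>

text \<open>The constants 0 and 1 are constructors, hence distinct from all ports.  Parentheses
  are implicit in the term structure.\<close>

datatype 'p wai =
    AZero
  | AOne
  | APort 'p
  | APlus "'p wai" "'p wai"
  | ATimes "'p wai" "'p wai"

primrec wai_sem ::
  "('p \<Rightarrow> 'k::{comm_semiring_0,comm_monoid_mult}) \<Rightarrow> 'p wai \<Rightarrow> 'p set set \<Rightarrow> 'k" where
  "wai_sem k AZero \<gamma> = 0"
| "wai_sem k AOne \<gamma> = (if {} \<in> \<gamma> then 1 else 0)"
| "wai_sem k (APort p) \<gamma> = (if \<exists>a\<in>\<gamma>. p \<in> a then k p else 0)"
| "wai_sem k (APlus z1 z2) \<gamma> = (\<Sum>a\<in>\<gamma>. wai_sem k z1 {a} + wai_sem k z2 {a})"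
| "wai_sem k (ATimes z1 z2) \<gamma> =
     (\<Sum>a\<in>\<gamma>. \<Sum>(a1, a2)\<in>{(a1, a2). a1 \<union> a2 = a}. wai_sem k z1 {a1} * wai_sem k z2 {a2})"

definition wai_equiv ::
  "'p set \<Rightarrow> ('p \<Rightarrow> 'k::{comm_semiring_0,comm_monoid_mult}) \<Rightarrow> 'p wai \<Rightarrow> 'p wai \<Rightarrow> bool" where
  "wai_equiv P k z1 z2 \<longleftrightarrow> (\<forall>\<gamma>. \<gamma> \<subseteq> Pow P \<longrightarrow> wai_sem k z1 \<gamma> = wai_sem k z2 \<gamma>)"

text \<open>Finite sums and products of terms; the choice of bracketing is immaterial modulo
  \<^const>\<open>wai_equiv\<close>.\<close>

fun wai_sum :: "'p wai list \<Rightarrow> 'p wai" where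
  "wai_sum [] = AZero"
| "wai_sum [z] = z"
| "wai_sum (z # y # zs) = APlus z (wai_sum (y # zs))"

fun wai_prod :: "'p wai list \<Rightarrow> 'p wai" where
  "wai_prod [] = AOne"
| "wai_prod [z] = z"
| "wai_prod (z # y # zs) = ATimes z (wai_prod (y # zs))"


section \<open>The weighted Algebra of Connectors\<close>

text \<open>\<open>Synchron\<close> is the typing exponent 0, \<open>Trigger\<close> the typing exponent 1.\<close>

datatype typing = Synchron | Trigger

text \<open>\<open>CZero \<alpha>\<close>, \<open>COne \<alpha>\<close>, \<open>CPort \<alpha> p\<close> and \<open>CTyped \<alpha> \<zeta>\<close> are the typed connectors
  obtained from 0, 1, a port \<open>p\<close> and a connector \<open>\<zeta>\<close>.\<close>

datatype 'p wac =
    CZero typing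
  | COne typing
  | CPort typing 'p
  | CTyped typing "'p wac"
  | CPlus "'p wac" "'p wac"
  | CFuse "'p wac" "'p wac"

primrec fusion_of_typed :: "'p wac \<Rightarrow> bool" where
  "fusion_of_typed (CZero \<alpha>) = True"
| "fusion_of_typed (COne \<alpha>) = True"
| "fusion_of_typed (CPort \<alpha> p) = True"
| "fusion_of_typed (CTyped \<alpha> \<zeta>) = True"
| "fusion_of_typed (CPlus \<zeta>1 \<zeta>2) = False"
| "fusion_of_typed (CFuse \<zeta>1 \<zeta>2) = (fusion_of_typed \<zeta>1 \<and> fusion_of_typed \<zeta>2)"

text \<open>Fusion is applied to typed connectors only; nested binary fusions stand for n-ary ones.\<close>

inductive_set wAC :: "'p set \<Rightarrow> 'p wac set" for Q :: "'p set" where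
  zero: "CZero \<alpha> \<in> wAC Q"
| one: "COne \<alpha> \<in> wAC Q"
| port: "p \<in> Q \<Longrightarrow> CPort \<alpha> p \<in> wAC Q"
| typed: "\<zeta> \<in> wAC Q \<Longrightarrow> CTyped \<alpha> \<zeta> \<in> wAC Q"
| plus: "\<zeta>1 \<in> wAC Q \<Longrightarrow> \<zeta>2 \<in> wAC Q \<Longrightarrow> CPlus \<zeta>1 \<zeta>2 \<in> wAC Q"
| fuse: "\<zeta>1 \<in> wAC Q \<Longrightarrow> \<zeta>2 \<in> wAC Q \<Longrightarrow> fusion_of_typed \<zeta>1 \<Longrightarrow> fusion_of_typed \<zeta>2
    \<Longrightarrow> CFuse \<zeta>1 \<zeta>2 \<in> wAC Q"

text \<open>Semantics of an n-ary fusion, given the types and the semantics of its arguments.\<close>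

definition fusion_sem :: "(typing \<times> 'p wai) list \<Rightarrow> 'p wai" where
  "fusion_sem xs =
     (let n = length xs; \<alpha> = (\<lambda>i. fst (xs ! i)); z = (\<lambda>i. snd (xs ! i)) in
      if \<forall>i<n. \<alpha> i = Synchron
      then wai_prod (map z [0..<n])
      else wai_sum
        [wai_prod (z i # [APlus AOne (z k). k \<leftarrow> [0..<n], k \<noteq> i \<and> \<alpha> k = Trigger]
                       @ [APlus AOne (z j). j \<leftarrow> [0..<n], \<alpha> j = Synchron]).
         i \<leftarrow> [0..<n], \<alpha> i = Trigger])"

text \<open>\<open>fusion_args \<zeta>\<close> lists the arguments that \<open>\<zeta>\<close> contributes to an enclosing fusion.
  If \<open>\<zeta>\<close> is a fusion of typed connectors, the outer list is a singleton.  Sums inside a fusion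
  lie outside \<^const>\<open>wAC\<close>, but substituting an untyped sum for a port can produce them; fusion then
  distributes over the sum, and the outer list ranges over the summands.\<close>

fun wac_sem :: "'p wac \<Rightarrow> 'p wai"
  and fusion_args :: "'p wac \<Rightarrow> (typing \<times> 'p wai) list list" where
  "wac_sem (CZero \<alpha>) = AZero"
| "wac_sem (COne \<alpha>) = AOne"
| "wac_sem (CPort \<alpha> p) = APort p"
| "wac_sem (CTyped \<alpha> \<zeta>) = wac_sem \<zeta>"
| "wac_sem (CPlus \<zeta>1 \<zeta>2) = APlus (wac_sem \<zeta>1) (wac_sem \<zeta>2)"
| "wac_sem (CFuse \<zeta>1 \<zeta>2) =
     wai_sum [fusion_sem (xs @ ys). xs \<leftarrow> fusion_args \<zeta>1, ys \<leftarrow> fusion_args \<zeta>2]"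
| "fusion_args (CZero \<alpha>) = [[(\<alpha>, AZero)]]"
| "fusion_args (COne \<alpha>) = [[(\<alpha>, AOne)]]"
| "fusion_args (CPort \<alpha> p) = [[(\<alpha>, APort p)]]"
| "fusion_args (CTyped \<alpha> \<zeta>) = [[(\<alpha>, wac_sem \<zeta>)]]"
| "fusion_args (CPlus \<zeta>1 \<zeta>2) = fusion_args \<zeta>1 @ fusion_args \<zeta>2"
| "fusion_args (CFuse \<zeta>1 \<zeta>2) = [xs @ ys. xs \<leftarrow> fusion_args \<zeta>1, ys \<leftarrow> fusion_args \<zeta>2]"

definition wac_equiv ::
  "'p set \<Rightarrow> ('p \<Rightarrow> 'k::{comm_semiring_0,comm_monoid_mult}) \<Rightarrow> 'p wac \<Rightarrow> 'p wac \<Rightarrow> bool" where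
  "wac_equiv P k \<zeta>1 \<zeta>2 \<longleftrightarrow> wai_equiv P k (wac_sem \<zeta>1) (wac_sem \<zeta>2)"

text \<open>The connector \<open>r\<close> is the synchron \<open>[r]\<close> with its brackets omitted, so \<open>\<zeta>\<close> replaces \<open>[r]\<close>
  including the brackets; the trigger \<open>[r]'\<close> becomes \<open>[\<zeta>]'\<close>.  Replacing \<open>[r]\<close> by \<open>[\<zeta>]\<close> is
  subsumed via contexts containing \<open>[[r]]\<close>.\<close>

primrec wac_subst :: "'p \<Rightarrow> 'p wac \<Rightarrow> 'p wac \<Rightarrow> 'p wac" where
  "wac_subst r \<zeta> (CZero \<alpha>) = CZero \<alpha>"
| "wac_subst r \<zeta> (COne \<alpha>) = COne \<alpha>"
| "wac_subst r \<zeta> (CPort \<alpha> p) =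
     (if p = r then (case \<alpha> of Synchron \<Rightarrow> \<zeta> | Trigger \<Rightarrow> CTyped Trigger \<zeta>) else CPort \<alpha> p)"
| "wac_subst r \<zeta> (CTyped \<alpha> E) = CTyped \<alpha> (wac_subst r \<zeta> E)"
| "wac_subst r \<zeta> (CPlus E1 E2) = CPlus (wac_subst r \<zeta> E1) (wac_subst r \<zeta> E2)"
| "wac_subst r \<zeta> (CFuse E1 E2) = CFuse (wac_subst r \<zeta> E1) (wac_subst r \<zeta> E2)"

text \<open>The defining condition is preserved by unions, so the union of all relations satisfying it
  is the largest one.\<close>

definition wac_cong ::
  "'p set \<Rightarrow> ('p \<Rightarrow> 'k::{comm_semiring_0,comm_monoid_mult}) \<Rightarrow> 'p \<Rightarrow> ('p wac \<times> 'p wac) set" where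
  "wac_cong P k r =
     \<Union>{R. R \<subseteq> wAC P \<times> wAC P \<and>
         (\<forall>(\<zeta>1, \<zeta>2)\<in>R. wac_equiv P k \<zeta>1 \<zeta>2 \<and>
            (\<forall>E\<in>wAC (insert r P). wac_equiv P k (wac_subst r \<zeta>1 E) (wac_subst r \<zeta>2 E)))}"

end

theory Submission imports Defs begin

text \<open>The semantics of a fusion is built from the types and the \<open>\<oplus>\<close>/\<open>\<otimes>\<close>-terms of its
  arguments, and equivalence of terms is a congruence for both operations. Replacing a port by a
  typed connector contributes exactly one argument, of a fixed type, to each enclosing fusion, so
  substituting equivalent connectors under the same type preserves every context up to
  equivalence. Conversely, typing does not change the semantics, so the trivial context suffices.\<close>

lemma wai_equiv_refl [simp]: "wai_equiv P k z z"
  by (simp add: wai_equiv_def)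

lemma wai_equiv_APlus:
  assumes "wai_equiv P k x x'" and "wai_equiv P k y y'"
  shows "wai_equiv P k (APlus x y) (APlus x' y')"
  unfolding wai_equiv_def
proof (intro allI impI)
  fix \<gamma> assume "\<gamma> \<subseteq> Pow P"
  then have "{a} \<subseteq> Pow P" if "a \<in> \<gamma>" for a
    using that by blast
  with assms have "wai_sem k x {a} = wai_sem k x' {a}" "wai_sem k y {a} = wai_sem k y' {a}"
    if "a \<in> \<gamma>" for a
    using that unfolding wai_equiv_def by simp_all
  then show "wai_sem k (APlus x y) \<gamma> = wai_sem k (APlus x' y') \<gamma>"
    by simp
qed

lemma wai_equiv_ATimes:
  assumes "wai_equiv P k x x'" and "wai_equiv P k y y'"
  shows "wai_equiv P k (ATimes x y) (ATimes x' y')"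
  unfolding wai_equiv_def
proof (intro allI impI)
  fix \<gamma> assume "\<gamma> \<subseteq> Pow P"
  \<comment> \<open>Both parts of a splitting lie below their union, a member of
    \<open>\<gamma>\<close>, so equivalence over \<open>P\<close> applies to each.\<close>
  then have "{a1} \<subseteq> Pow P" "{a2} \<subseteq> Pow P" if "a1 \<union> a2 \<in> \<gamma>" for a1 a2
    using that by blast+
  with assms have "wai_sem k x {a1} = wai_sem k x' {a1}" "wai_sem k y {a2} = wai_sem k y' {a2}"
    if "a1 \<union> a2 \<in> \<gamma>" for a1 a2
    using that unfolding wai_equiv_def by meson+
  then show "wai_sem k (ATimes x y) \<gamma> = wai_sem k (ATimes x' y') \<gamma>"
    by (auto intro!: sum.cong)
qed

lemma wai_equiv_wai_sum:
  "list_all2 (wai_equiv P k) xs ys \<Longrightarrow> wai_equiv P k (wai_sum xs) (wai_sum ys)"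
proof (induction rule: list_all2_induct)
  case (Cons x xs y ys)
  then show ?case
    \<comment> \<open>\<open>wai_sum\<close> ends in its last entry instead of \<open>AZero\<close>,
      so empty tails form a separate case.\<close>
    by (cases xs; cases ys) (simp_all add: wai_equiv_APlus)
qed simp

lemma wai_equiv_wai_prod:
  "list_all2 (wai_equiv P k) xs ys \<Longrightarrow> wai_equiv P k (wai_prod xs) (wai_prod ys)"
proof (induction rule: list_all2_induct)
  case (Cons x xs y ys)
  then show ?case
    by (cases xs; cases ys) (simp_all add: wai_equiv_ATimes)
qed simp

lemma list_all2_concat_map:
  assumes "list_all2 R xs ys" and "\<And>x y. R x y \<Longrightarrow> list_all2 S (f x) (g y)"
  shows "list_all2 S (concat (map f xs)) (concat (map g ys))"
  using assms(1) by induction (auto intro: list_all2_appendI assms(2))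

lemma list_all2_concat_map_same:
  assumes "\<And>x. x \<in> set xs \<Longrightarrow> list_all2 S (f x) (g x)"
  shows "list_all2 S (concat (map f xs)) (concat (map g xs))"
  using assms by (induction xs) (auto intro: list_all2_appendI)

text \<open>Fits the comprehension by which \<open>wac_sem\<close> and \<open>fusion_args\<close> of
  a \<open>CFuse\<close> combine the summands of its two sides.\<close>

lemma list_all2_products:
  assumes "list_all2 R xs xs'" and "list_all2 R' ys ys'"
    and "\<And>x x' y y'. R x x' \<Longrightarrow> R' y y' \<Longrightarrow> S (f x y) (f x' y')"
  shows "list_all2 S [f x y. x \<leftarrow> xs, y \<leftarrow> ys] [f x y. x \<leftarrow> xs', y \<leftarrow> ys']"
  using assms(1)
proof (rule list_all2_concat_map)
  fix x x' assume "R x x'"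
  with assms(2) show "list_all2 S (map (f x) ys) (map (f x') ys')"
    unfolding list.rel_map by (blast intro: list_all2_mono assms(3))
qed

text \<open>Types are compared by equality because they fix the shape of the term that
  \<open>fusion_sem\<close> builds.\<close>

abbreviation fusion_arg_equiv where
  "fusion_arg_equiv P k \<equiv> rel_prod (=) (wai_equiv P k)"

text \<open>Equal types select the same branch and the same indices, so the two terms match entry by
  entry.\<close>

lemma wai_equiv_fusion_sem:
  assumes "list_all2 (fusion_arg_equiv P k) xs ys"
  shows "wai_equiv P k (fusion_sem xs) (fusion_sem ys)"
proof -
  have len: "length ys = length xs"
    using assms by (simp add: list_all2_lengthD)
  have types: "fst (ys ! i) = fst (xs ! i)"
    and equiv: "wai_equiv P k (snd (xs ! i)) (snd (ys ! i))" if "i < length xs" for i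
    using list_all2_nthD[OF assms that] by (auto simp: rel_prod_sel)
  show ?thesis
  proof (cases "\<forall>i<length xs. fst (xs ! i) = Synchron")
    case True
    then show ?thesis
      by (auto simp: fusion_sem_def Let_def len types equiv list.rel_map
          intro!: wai_equiv_wai_prod list.rel_refl_strong)
  next
    case False
    then have "\<not> (\<forall>i<length ys. fst (ys ! i) = Synchron)"
      by (simp add: len types)
    with False show ?thesis
      unfolding fusion_sem_def Let_def len
      by (simp only: if_False)
        (auto simp: types equiv intro!: wai_equiv_wai_sum wai_equiv_wai_prod wai_equiv_APlus
          list_all2_concat_map_same list_all2_appendI)
  qed
qed

text \<open>The second conjunct makes the induction work: the semantics of a \<open>CFuse\<close> is
  computed from the \<open>fusion_args\<close> of its parts, not from their
  \<open>wac_sem\<close>.\<close>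

lemma wac_subst_CTyped_equiv:
  assumes "wai_equiv P k (wac_sem \<zeta>1) (wac_sem \<zeta>2)"
  shows "wai_equiv P k (wac_sem (wac_subst r (CTyped \<alpha> \<zeta>1) E)) (wac_sem (wac_subst r (CTyped \<alpha> \<zeta>2) E))
    \<and> list_all2 (list_all2 (fusion_arg_equiv P k))
        (fusion_args (wac_subst r (CTyped \<alpha> \<zeta>1) E)) (fusion_args (wac_subst r (CTyped \<alpha> \<zeta>2) E))"
proof (induction E)
  \<comment> \<open>At \<open>r\<close>, both sides yield a single argument, of type
    \<open>\<alpha>\<close> if \<open>\<beta>\<close> is \<open>Synchron\<close> and of type
    \<open>Trigger\<close> otherwise. Bare \<open>\<zeta>1\<close> and \<open>\<zeta>2\<close> could
    yield arguments differing in number and type.\<close>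
  case (CPort \<beta> p)
  then show ?case
    using assms by (cases \<beta>) auto
next
  case (CPlus E1 E2)
  then show ?case
    by (auto intro: wai_equiv_APlus list_all2_appendI)
next
  case (CFuse E1 E2)
  then have args: "list_all2 (list_all2 (fusion_arg_equiv P k))
      (fusion_args (wac_subst r (CTyped \<alpha> \<zeta>1) E)) (fusion_args (wac_subst r (CTyped \<alpha> \<zeta>2) E))"
    if "E = E1 \<or> E = E2" for E
    using that by blast
  show ?case
    unfolding wac_subst.simps wac_sem.simps fusion_args.simps
    by (intro conjI wai_equiv_wai_sum list_all2_products[OF args args] wai_equiv_fusion_sem
        list_all2_appendI) simp_all
qed auto

theorem theorem1:
  fixes P :: "'p set"
    and r :: 'p
    and k :: "'p \<Rightarrow> 'k::{comm_semiring_0,comm_monoid_mult}"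
    and \<zeta>1 \<zeta>2 :: "'p wac"
    and \<alpha> :: typing
  assumes "\<And>x::'k. x + x = x"
    and "finite P" and "P \<noteq> {}" and "r \<notin> P"
    and "\<zeta>1 \<in> wAC P" and "\<zeta>2 \<in> wAC P"
  shows "wac_equiv P k \<zeta>1 \<zeta>2 \<longleftrightarrow> (CTyped \<alpha> \<zeta>1, CTyped \<alpha> \<zeta>2) \<in> wac_cong P k r"
proof
  assume equiv: "wac_equiv P k \<zeta>1 \<zeta>2"
  then have "wac_equiv P k (wac_subst r (CTyped \<alpha> \<zeta>1) E) (wac_subst r (CTyped \<alpha> \<zeta>2) E)" for E
    unfolding wac_equiv_def by (intro conjunct1[OF wac_subst_CTyped_equiv])
  moreover have "wac_equiv P k (CTyped \<alpha> \<zeta>1) (CTyped \<alpha> \<zeta>2)"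
    using equiv by (simp add: wac_equiv_def)
  ultimately show "(CTyped \<alpha> \<zeta>1, CTyped \<alpha> \<zeta>2) \<in> wac_cong P k r"
    \<comment> \<open>The condition on \<open>R\<close> constrains each pair separately, so a
      singleton relation is a witness.\<close>
    unfolding wac_cong_def
    by (intro UnionI[of "{(CTyped \<alpha> \<zeta>1, CTyped \<alpha> \<zeta>2)}"]) (auto intro: wAC.typed assms(5,6))
next
  assume "(CTyped \<alpha> \<zeta>1, CTyped \<alpha> \<zeta>2) \<in> wac_cong P k r"
  \<comment> \<open>Equivalence is itself part of the condition on \<open>R\<close>.\<close>
  then have "wac_equiv P k (CTyped \<alpha> \<zeta>1) (CTyped \<alpha> \<zeta>2)"
    unfolding wac_cong_def by blast
  then show "wac_equiv P k \<zeta>1 \<zeta>2"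
    by (simp add: wac_equiv_def)
qed

end
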